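(* Let $D\ge 1$ and $d\ge 1$ be integers, let $h$ be a Hermitian operator on $(\mathbb{C}^d)^{\otimes 2^D}$, and for $N=n^D$ let $H_N=\sum_{j\in\mathcal{L}}\tau_j(h)$ be the associated translationally invariant Hamiltonian with periodic boundary conditions on the cubic lattice $\mathcal{L}$ of $N=n^D$ sites. For an integer $m\ge 2$ let $h_m$ be the corresponding Hamiltonian on a cubic patch of $m^D$ sites with open boundary conditions, and let $\lambda_{\min}(h_m)$ be its smallest eigenvalue. Let $e_{\min}=\limsup_{n\to\infty}\frac{1}{n^D}\lambda_{\min}(H_{n^D})$ be the asymptotic ground state energy density. Then $$A(m,D):=\frac{\lambda_{\min}(h_m)}{(m-1)^D}\le e_{\min},$$ and $$\left|e_{\min}-A(m,D)\right|\le \frac{D}{m}\|h\|-\lambda_{\min}(h_m)\left[\frac{1}{(m-1)^D}-\frac{1}{m^D}\right].$$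
   Context: The lattice is $\mathcal{L}=(\mathbb{Z}/n\mathbb{Z})^D$ (cubic, periodic boundary conditions), with $|\mathcal{L}|=N=n^D$ sites, each carrying a copy of $\mathbb{C}^d$, so that $H_N$ acts on $(\mathbb{C}^d)^{\otimes N}$. The interaction term $h$ is supported on $2^D$ sites, namely an elementary cube $\{0,1\}^D$. For a root site $j\in\mathcal{L}$, $\tau_j(h)$ denotes the operator acting as $h$ on the sites $j+\{0,1\}^D$ (addition modulo $n$ in each coordinate) and as the identity on all other sites. The patch Hamiltonian with open boundary conditions is the operator $h_m=\sum_{j\in\{1,\dots,m-1\}^D}\tau_j(h)$ on $(\mathbb{C}^d)^{\otimes m^D}$, the sites being $\{1,\dots,m\}^D$; that is, the sum of all $(m-1)^D$ translates of $h$ whose support lies entirely inside the patch. $\lambda_{\min}(\cdot)$ is the smallest eigenvalue and $\|\cdot\|$ the operator norm. *)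

theory Defs
  imports "HOL-Analysis.Analysis"
begin

(* The Hilbert space with orthonormal basis indexed by a finite set X is represented by
   functions on X with complex values (values outside X are irrelevant), and an operator on it
   by its matrix elements A x y with x and y in X. *)

type_synonym 'i kernel = "'i \<Rightarrow> 'i \<Rightarrow> complex"

definition apply_op :: "'i set \<Rightarrow> 'i kernel \<Rightarrow> ('i \<Rightarrow> complex) \<Rightarrow> 'i \<Rightarrow> complex" where
  "apply_op X A \<psi> = (\<lambda>x. \<Sum>y\<in>X. A x y * \<psi> y)"

definition hermitian_op :: "'i set \<Rightarrow> 'i kernel \<Rightarrow> bool" where
  "hermitian_op X A \<longleftrightarrow> (\<forall>x\<in>X. \<forall>y\<in>X. A x y = cnj (A y x))"

definition eigenvalue_op :: "'i set \<Rightarrow> 'i kernel \<Rightarrow> complex \<Rightarrow> bool" where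
  "eigenvalue_op X A e \<longleftrightarrow>
     (\<exists>\<psi>. (\<exists>x\<in>X. \<psi> x \<noteq> 0) \<and> (\<forall>x\<in>X. apply_op X A \<psi> x = e * \<psi> x))"

(* Only meaningful for Hermitian operators on a nonzero space, where all eigenvalues are real. *)
definition lambda_min :: "'i set \<Rightarrow> 'i kernel \<Rightarrow> real" where
  "lambda_min X A = (LEAST e. eigenvalue_op X A (complex_of_real e))"

definition vec_norm :: "'i set \<Rightarrow> ('i \<Rightarrow> complex) \<Rightarrow> real" where
  "vec_norm X \<psi> = L2_set (\<lambda>x. cmod (\<psi> x)) X"

definition op_norm :: "'i set \<Rightarrow> 'i kernel \<Rightarrow> real" where
  "op_norm X A = (SUP \<psi>\<in>{\<psi>. vec_norm X \<psi> \<le> 1}. vec_norm X (apply_op X A \<psi>))"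

type_synonym site = "nat \<Rightarrow> nat"

definition grid :: "nat \<Rightarrow> nat set \<Rightarrow> site set" where
  "grid D I = {..<D} \<rightarrow>\<^sub>E I"

abbreviation cube :: "nat \<Rightarrow> site set" where
  "cube D \<equiv> grid D {0, 1}"

(* The residue classes modulo n are represented by 0, ..., n - 1. *)
abbreviation torus :: "nat \<Rightarrow> nat \<Rightarrow> site set" where
  "torus D n \<equiv> grid D {..<n}"

abbreviation patch :: "nat \<Rightarrow> nat \<Rightarrow> site set" where
  "patch D m \<equiv> grid D {1..m}"

(* The standard product basis of the tensor power of C^d over the site set S:
   a basis vector assigns to each site one of the d basis states. *)
definition configs :: "nat \<Rightarrow> site set \<Rightarrow> (site \<Rightarrow> nat) set" where
  "configs d S = S \<rightarrow>\<^sub>E {..<d}"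

(* The operator on S that acts as h on the sites f a, where f a plays the role of the cube
   corner a, and as the identity on all other sites of S. It requires f to be injective from
   the cube into S. *)
definition local_op ::
  "nat \<Rightarrow> site set \<Rightarrow> (site \<Rightarrow> site) \<Rightarrow> (site \<Rightarrow> nat) kernel \<Rightarrow> (site \<Rightarrow> nat) kernel" where
  "local_op D S f h = (\<lambda>x y.
     if \<forall>s \<in> S - f ` cube D. x s = y s
     then h (\<lambda>a\<in>cube D. x (f a)) (\<lambda>a\<in>cube D. y (f a))
     else 0)"

definition translate :: "nat \<Rightarrow> site \<Rightarrow> site \<Rightarrow> site" where
  "translate D j a = (\<lambda>i\<in>{..<D}. j i + a i)"

definition translate_mod :: "nat \<Rightarrow> nat \<Rightarrow> site \<Rightarrow> site \<Rightarrow> site" where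
  "translate_mod D n j a = (\<lambda>i\<in>{..<D}. (j i + a i) mod n)"

(* For n < 2 the corners of a cube are not distinct sites of the torus, and the values of the
   next two definitions have no meaning. They do not affect the limit superior below. *)
definition H_periodic :: "nat \<Rightarrow> (site \<Rightarrow> nat) kernel \<Rightarrow> nat \<Rightarrow> (site \<Rightarrow> nat) kernel" where
  "H_periodic D h n = (\<lambda>x y. \<Sum>j\<in>torus D n. local_op D (torus D n) (translate_mod D n j) h x y)"

definition energy_density :: "nat \<Rightarrow> nat \<Rightarrow> (site \<Rightarrow> nat) kernel \<Rightarrow> nat \<Rightarrow> real" where
  "energy_density D d h n = 1 / real n ^ D * lambda_min (configs d (torus D n)) (H_periodic D h n)"

definition e_min :: "nat \<Rightarrow> nat \<Rightarrow> (site \<Rightarrow> nat) kernel \<Rightarrow> ereal" where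
  "e_min D d h = limsup (\<lambda>n. ereal (energy_density D d h n))"

definition h_patch :: "nat \<Rightarrow> (site \<Rightarrow> nat) kernel \<Rightarrow> nat \<Rightarrow> (site \<Rightarrow> nat) kernel" where
  "h_patch D h m =
     (\<lambda>x y. \<Sum>j\<in>grid D {1..m-1}. local_op D (patch D m) (translate D j) h x y)"

definition lambda_patch :: "nat \<Rightarrow> nat \<Rightarrow> (site \<Rightarrow> nat) kernel \<Rightarrow> nat \<Rightarrow> real" where
  "lambda_patch D d h m = lambda_min (configs d (patch D m)) (h_patch D h m)"

definition anderson_bound :: "nat \<Rightarrow> nat \<Rightarrow> (site \<Rightarrow> nat) kernel \<Rightarrow> nat \<Rightarrow> real" where
  "anderson_bound D d h m = lambda_patch D d h m / (real m - 1) ^ D"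

end

theory Submission imports Defs
begin

text \<open>Lower bound: summing the patch Hamiltonian over all positions on the torus gives
  \<open>(m - 1) ^ D\<close> copies of the periodic Hamiltonian, so by superadditivity of the smallest
  eigenvalue the patch energy per term bounds every finite-volume energy density from below.
  Upper bound: with \<open>k = n div m\<close>, put the patch ground state on \<open>k ^ D\<close> disjoint patches. The terms
  inside the patches contribute \<open>k ^ D\<close> times the patch energy, and each of the remaining
  \<open>n ^ D - k ^ D * (m - 1) ^ D\<close> terms contributes at most the norm of \<open>h\<close>. Dividing by \<open>n ^ D\<close>, letting
  \<open>n\<close> tend to infinity and using Bernoulli's inequality yields the second estimate.\<close>

section \<open>Quadratic forms and the variational principle\<close>

definition inner_on :: "'i set \<Rightarrow> ('i \<Rightarrow> complex) \<Rightarrow> ('i \<Rightarrow> complex) \<Rightarrow> complex" where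
  "inner_on X \<phi> \<psi> = (\<Sum>x\<in>X. cnj (\<phi> x) * \<psi> x)"

text \<open>Squared norms are plain sums, so they split additively over blocks of configurations;
  \<open>vec_norm_square\<close> links them to \<open>vec_norm\<close>.\<close>

definition norm_sq :: "'i set \<Rightarrow> ('i \<Rightarrow> complex) \<Rightarrow> real" where
  "norm_sq X \<psi> = (\<Sum>x\<in>X. (cmod (\<psi> x))\<^sup>2)"

text \<open>The real part yields a real quadratic form for an arbitrary kernel; for a Hermitian
  kernel the inner product is already real.\<close>

definition expect :: "'i set \<Rightarrow> 'i kernel \<Rightarrow> ('i \<Rightarrow> complex) \<Rightarrow> real" where
  "expect X A \<psi> = Re (inner_on X \<psi> (apply_op X A \<psi>))"

lemma inner_on_self: "inner_on X \<psi> \<psi> = of_real (norm_sq X \<psi>)"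
  unfolding inner_on_def norm_sq_def of_real_sum
  by (intro sum.cong refl) (metis complex_norm_square mult.commute)

lemma norm_sq_nonneg: "0 \<le> norm_sq X \<psi>"
  by (simp add: norm_sq_def sum_nonneg)

lemma norm_sq_eq_0_iff: "finite X \<Longrightarrow> norm_sq X \<psi> = 0 \<longleftrightarrow> (\<forall>x\<in>X. \<psi> x = 0)"
  by (simp add: norm_sq_def sum_nonneg_eq_0_iff)

lemma norm_sq_pos: "finite X \<Longrightarrow> x \<in> X \<Longrightarrow> \<psi> x \<noteq> 0 \<Longrightarrow> 0 < norm_sq X \<psi>"
  using norm_sq_nonneg[of X \<psi>] norm_sq_eq_0_iff[of X \<psi>] by force

lemma norm_sq_scale: "norm_sq X (\<lambda>x. c * \<psi> x) = (cmod c)\<^sup>2 * norm_sq X \<psi>"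
  by (simp add: norm_sq_def norm_mult power_mult_distrib sum_distrib_left)

lemma expect_scale: "expect X A (\<lambda>x. c * \<psi> x) = (cmod c)\<^sup>2 * expect X A \<psi>"
proof -
  have "inner_on X (\<lambda>x. c * \<psi> x) (apply_op X A (\<lambda>x. c * \<psi> x))
      = (cnj c * c) * inner_on X \<psi> (apply_op X A \<psi>)"
    by (simp add: inner_on_def apply_op_def sum_distrib_left mult_ac)
  also have "cnj c * c = of_real ((cmod c)\<^sup>2)"
    by (metis complex_norm_square mult.commute)
  finally show ?thesis
    by (simp add: expect_def)
qed

lemma expect_cong:
  assumes "\<And>x. x \<in> X \<Longrightarrow> \<phi> x = \<psi> x"
  shows "expect X A \<phi> = expect X A \<psi>"
  using assms by (simp add: expect_def inner_on_def apply_op_def cong: sum.cong)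

lemma norm_sq_cong:
  assumes "\<And>x. x \<in> X \<Longrightarrow> \<phi> x = \<psi> x"
  shows "norm_sq X \<phi> = norm_sq X \<psi>"
  using assms by (simp add: norm_sq_def cong: sum.cong)

lemma expect_sum:
  "expect X (\<lambda>x y. \<Sum>j\<in>J. A j x y) \<psi> = (\<Sum>j\<in>J. expect X (A j) \<psi>)"
proof -
  have "apply_op X (\<lambda>x y. \<Sum>j\<in>J. A j x y) \<psi> x = (\<Sum>j\<in>J. apply_op X (A j) \<psi> x)" for x
    unfolding apply_op_def sum_distrib_right by (rule sum.swap)
  then have "inner_on X \<psi> (apply_op X (\<lambda>x y. \<Sum>j\<in>J. A j x y) \<psi>)
      = (\<Sum>j\<in>J. inner_on X \<psi> (apply_op X (A j) \<psi>))"
    unfolding inner_on_def by (simp add: sum_distrib_left) (rule sum.swap)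
  then show ?thesis
    by (simp add: expect_def)
qed

lemma inner_on_apply_op_commute:
  assumes "hermitian_op X A"
  shows "inner_on X \<phi> (apply_op X A \<psi>) = cnj (inner_on X \<psi> (apply_op X A \<phi>))"
proof -
  have "inner_on X \<phi> (apply_op X A \<psi>) = (\<Sum>x\<in>X. \<Sum>y\<in>X. cnj (\<phi> x) * A x y * \<psi> y)"
    by (simp add: inner_on_def apply_op_def sum_distrib_left mult_ac)
  also have "\<dots> = (\<Sum>y\<in>X. \<Sum>x\<in>X. cnj (\<phi> x) * A x y * \<psi> y)"
    by (rule sum.swap)
  also have "\<dots> = (\<Sum>y\<in>X. \<Sum>x\<in>X. cnj (cnj (\<psi> y) * (A y x * \<phi> x)))"
    using assms unfolding hermitian_op_def
    by (intro sum.cong refl) (metis complex_cnj_cnj complex_cnj_mult mult.assoc mult.commute)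
  also have "\<dots> = cnj (inner_on X \<psi> (apply_op X A \<phi>))"
    by (simp add: inner_on_def apply_op_def sum_distrib_left)
  finally show ?thesis .
qed

text \<open>A zero of a nonnegative quadratic form is a minimum, so its first variation
  vanishes; the variation is taken in the direction of the residual vector.\<close>

lemma apply_op_eq_0_if_expect_eq_0:
  assumes X: "finite X" and B: "hermitian_op X B"
    and nonneg: "\<And>\<phi>. 0 \<le> expect X B \<phi>" and zero: "expect X B \<psi> = 0" and x: "x \<in> X"
  shows "apply_op X B \<psi> x = 0"
proof -
  define \<rho> where "\<rho> = apply_op X B \<psi>"
  define N where "N = norm_sq X \<rho>"
  define K where "K = expect X B \<rho>"
  \<comment> \<open>The constant term vanishes by \<open>zero\<close>, and hermiticity makes both
    cross terms equal to \<open>t * N\<close>.\<close>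
  have var: "expect X B (\<lambda>x. \<psi> x - of_real t * \<rho> x) = - (2 * t * N) + t\<^sup>2 * K" for t :: real
  proof -
    have "apply_op X B (\<lambda>x. \<psi> x - of_real t * \<rho> x) = (\<lambda>x. \<rho> x - of_real t * apply_op X B \<rho> x)"
      by (simp add: apply_op_def \<rho>_def fun_eq_iff algebra_simps sum_subtractf sum_distrib_left)
    then have "inner_on X (\<lambda>x. \<psi> x - of_real t * \<rho> x) (apply_op X B (\<lambda>x. \<psi> x - of_real t * \<rho> x))
      = inner_on X \<psi> \<rho> - of_real t * inner_on X \<psi> (apply_op X B \<rho>)
        - of_real t * inner_on X \<rho> \<rho> + of_real (t\<^sup>2) * inner_on X \<rho> (apply_op X B \<rho>)"
      by (simp add: inner_on_def algebra_simps sum_subtractf sum.distrib sum_distrib_left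
          power2_eq_square)
    moreover have "inner_on X \<psi> (apply_op X B \<rho>) = of_real N"
      using inner_on_apply_op_commute[OF B, of \<psi> \<rho>] by (simp add: \<rho>_def[symmetric] inner_on_self N_def)
    ultimately show ?thesis
      using zero by (simp add: expect_def K_def inner_on_self N_def[symmetric] \<rho>_def[symmetric])
  qed
  have "N = 0"
  proof (rule ccontr)
    assume "N \<noteq> 0"
    then have N: "0 < N"
      using norm_sq_nonneg[of X \<rho>] by (simp add: N_def)
    \<comment> \<open>So small that the quadratic term is at most \<open>t * N\<close>, half the
      size of the linear one; the \<open>+ 1\<close> covers \<open>K = 0\<close>.\<close>
    define t where "t = N / (\<bar>K\<bar> + 1)"
    have t: "0 < t" using N by (simp add: t_def)
    have "t * \<bar>K\<bar> \<le> N" using N by (simp add: t_def divide_simps)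
    then have "t * K \<le> N" using t by (smt (verit) mult_left_mono)
    then have "- 2 * t * N + t\<^sup>2 * K \<le> - (t * N)"
      using mult_left_mono[of "t * K" N t] t by (simp add: power2_eq_square algebra_simps)
    with var[of t] nonneg[of "\<lambda>x. \<psi> x - of_real t * \<rho> x"] have "t * N \<le> 0" by linarith
    with t N show False by (simp add: mult_le_0_iff)
  qed
  then show ?thesis
    using X x by (simp add: N_def norm_sq_eq_0_iff \<rho>_def)
qed

text \<open>A continuous function attains its minimum on the compact unit sphere; since both sides
  are homogeneous of degree two, the inequality extends from unit vectors to all vectors.\<close>

lemma expect_minimiser:
  assumes X: "finite X" "X \<noteq> {}"
  obtains \<psi> where "norm_sq X \<psi> = 1" "\<And>\<phi>. expect X A \<psi> * norm_sq X \<phi> \<le> expect X A \<phi>"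
proof -
  \<comment> \<open>Vectors are functions on the whole type, so coordinates outside \<open>X\<close>
    are pinned to 0. Products of compact sets are compact, and the norm condition is closed.\<close>
  define K where "K = (PiE UNIV (\<lambda>x. if x \<in> X then cball (0::complex) 1 else {0})) \<inter> {\<psi>. norm_sq X \<psi> = 1}"
  have coord: "continuous_on UNIV (\<lambda>\<psi>::'a \<Rightarrow> complex. \<psi> x)" for x
    by simp
  have cn: "continuous_on UNIV (norm_sq X)"
    unfolding norm_sq_def by (intro continuous_intros coord)
  have ce: "continuous_on UNIV (expect X A)"
    unfolding expect_def inner_on_def apply_op_def by (intro continuous_intros coord)
  have "compactin (product_topology (\<lambda>_. euclidean) UNIV)
      (PiE UNIV (\<lambda>x::'a. if x \<in> X then cball (0::complex) 1 else {0}))"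
    by (subst compactin_PiE) auto
  then have "compact (PiE UNIV (\<lambda>x::'a. if x \<in> X then cball (0::complex) 1 else {0}))"
    by (simp add: euclidean_product_topology)
  moreover have "closed {\<psi>. norm_sq X \<psi> = 1}"
    by (rule closed_Collect_eq[OF cn]) simp
  ultimately have K: "compact K"
    unfolding K_def by (rule compact_Int_closed)
  have K_I: "(\<lambda>x. if x \<in> X then \<phi> x else 0) \<in> K" if "norm_sq X \<phi> = 1" for \<phi>
  proof -
    have "(cmod (\<phi> x))\<^sup>2 \<le> 1" if "x \<in> X" for x
      using member_le_sum[of x X "\<lambda>x. (cmod (\<phi> x))\<^sup>2"] X that \<open>norm_sq X \<phi> = 1\<close>
      by (simp add: norm_sq_def)
    then have "cmod (\<phi> x) \<le> 1" if "x \<in> X" for x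
      using that by (simp add: abs_square_le_1)
    moreover have "norm_sq X (\<lambda>x. if x \<in> X then \<phi> x else 0) = 1"
      using that by (simp add: norm_sq_def cong: sum.cong)
    ultimately show ?thesis by (auto simp: K_def)
  qed
  obtain x0 where x0: "x0 \<in> X" using X by blast
  have "norm_sq X (\<lambda>x. if x = x0 then 1 else 0) = 1"
    using X x0 by (simp add: norm_sq_def if_distrib[of "\<lambda>z. (cmod z)\<^sup>2"] cong: if_cong)
  with K_I have "K \<noteq> {}" by blast
  then obtain \<psi> where \<psi>: "\<psi> \<in> K" and min: "\<And>\<phi>. \<phi> \<in> K \<Longrightarrow> expect X A \<psi> \<le> expect X A \<phi>"
    using continuous_attains_inf[OF K _ continuous_on_subset[OF ce]] by blast
  have "expect X A \<psi> * norm_sq X \<phi> \<le> expect X A \<phi>" for \<phi>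
  proof (cases "norm_sq X \<phi> = 0")
    case True
    then have "expect X A \<phi> = 0"
      using X by (simp add: norm_sq_eq_0_iff expect_def inner_on_def)
    with True show ?thesis by simp
  next
    case False
    then have N: "0 < norm_sq X \<phi>" using norm_sq_nonneg[of X \<phi>] by simp
    define c :: complex where "c = of_real (1 / sqrt (norm_sq X \<phi>))"
    have c: "(cmod c)\<^sup>2 = 1 / norm_sq X \<phi>"
      using N by (simp add: c_def power_divide norm_divide)
    have "norm_sq X (\<lambda>x. c * \<phi> x) = 1"
      using N by (simp add: norm_sq_scale c)
    from min[OF K_I[OF this]] have "expect X A \<psi> \<le> expect X A (\<lambda>x. c * \<phi> x)"
      by (simp add: expect_def inner_on_def apply_op_def cong: sum.cong)
    with N show ?thesis by (simp add: expect_scale c field_simps)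
  qed
  with \<psi> that show ?thesis by (auto simp: K_def)
qed

lemma expect_eigenvector:
  assumes "\<And>x. x \<in> X \<Longrightarrow> apply_op X A \<psi> x = of_real e * \<psi> x"
  shows "expect X A \<psi> = e * norm_sq X \<psi>"
proof -
  have "inner_on X \<psi> (apply_op X A \<psi>) = of_real e * inner_on X \<psi> \<psi>"
    using assms by (simp add: inner_on_def sum_distrib_left mult_ac cong: sum.cong)
  then show ?thesis by (simp add: expect_def inner_on_self)
qed

text \<open>Subtracting the minimal Rayleigh quotient \<open>e\<close> leaves a nonnegative form
  that vanishes at the minimiser, which is therefore an eigenvector. Every eigenvalue is itself a
  Rayleigh quotient, so none lies below \<open>e\<close>. All later arguments use
  \<open>lambda_min\<close> only through these two facts.\<close>

lemma lambda_min_props: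
  assumes X: "finite X" "X \<noteq> {}" and A: "hermitian_op X A"
  shows lambda_min_le: "lambda_min X A * norm_sq X \<phi> \<le> expect X A \<phi>"
    and lambda_min_attained:
      "\<exists>\<psi>. (\<exists>x\<in>X. \<psi> x \<noteq> 0) \<and> expect X A \<psi> = lambda_min X A * norm_sq X \<psi>"
proof -
  obtain \<psi> where \<psi>: "norm_sq X \<psi> = 1"
    and min: "\<And>\<phi>. expect X A \<psi> * norm_sq X \<phi> \<le> expect X A \<phi>"
    using expect_minimiser[OF X] by metis
  define e where "e = expect X A \<psi>"
  define B where "B = (\<lambda>x y. A x y - (if x = y then of_real e else 0))"
  have apply_B: "apply_op X B \<phi> x = apply_op X A \<phi> x - of_real e * \<phi> x" if "x \<in> X" for \<phi> x
    using X that
    by (simp add: apply_op_def B_def left_diff_distrib sum_subtractf if_distrib[of "\<lambda>z. z * _"]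
        cong: if_cong)
  have expect_B: "expect X B \<phi> = expect X A \<phi> - e * norm_sq X \<phi>" for \<phi>
  proof -
    have "inner_on X \<phi> (apply_op X B \<phi>) = inner_on X \<phi> (apply_op X A \<phi>) - of_real e * inner_on X \<phi> \<phi>"
      by (simp add: inner_on_def apply_B algebra_simps sum_subtractf sum_distrib_left cong: sum.cong)
    then show ?thesis by (simp add: expect_def inner_on_self)
  qed
  have herm_B: "hermitian_op X B"
    unfolding hermitian_op_def
  proof (intro ballI)
    fix x y assume "x \<in> X" "y \<in> X"
    with A have "A x y = cnj (A y x)"
      unfolding hermitian_op_def by blast
    then show "B x y = cnj (B y x)"
      unfolding B_def by simp
  qed
  have "apply_op X B \<psi> x = 0" if "x \<in> X" for x
    using apply_op_eq_0_if_expect_eq_0[OF X(1) herm_B _ _ that] min \<psi> expect_B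
    by (simp add: e_def)
  then have "\<forall>x\<in>X. apply_op X A \<psi> x = of_real e * \<psi> x"
    using apply_B by simp
  moreover have nz: "\<exists>x\<in>X. \<psi> x \<noteq> 0"
    using \<psi> X norm_sq_eq_0_iff[of X \<psi>] by fastforce
  ultimately have ev: "eigenvalue_op X A (of_real e)"
    by (auto simp: eigenvalue_op_def)
  have least: "e \<le> e'" if ev': "eigenvalue_op X A (of_real e')" for e'
  proof -
    obtain \<rho> x where x: "x \<in> X" "\<rho> x \<noteq> 0" and \<rho>: "\<And>x. x \<in> X \<Longrightarrow> apply_op X A \<rho> x = of_real e' * \<rho> x"
      using ev' unfolding eigenvalue_op_def by blast
    have "e * norm_sq X \<rho> \<le> e' * norm_sq X \<rho>"
      using min[of \<rho>] expect_eigenvector[OF \<rho>] by (simp add: e_def)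
    then show ?thesis using norm_sq_pos[OF X(1) x(1), of \<rho>] x(2) by simp
  qed
  \<comment> \<open>Over the reals \<open>LEAST\<close> is informative only if a minimum exists,
    which \<open>ev\<close> and \<open>least\<close> guarantee.\<close>
  have "lambda_min X A = e"
    unfolding lambda_min_def using ev least by (rule Least_equality)
  with min nz \<psi> show "lambda_min X A * norm_sq X \<phi> \<le> expect X A \<phi>"
    "\<exists>\<psi>. (\<exists>x\<in>X. \<psi> x \<noteq> 0) \<and> expect X A \<psi> = lambda_min X A * norm_sq X \<psi>"
    by (auto simp: e_def)
qed

section \<open>The operator norm as a bound on the quadratic form\<close>

lemma vec_norm_square: "(vec_norm X \<psi>)\<^sup>2 = norm_sq X \<psi>"
  by (simp add: vec_norm_def L2_set_def norm_sq_def sum_nonneg)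

text \<open>A real supremum is meaningful only for a bounded set; the sum of the moduli of all
  matrix elements serves as a bound.\<close>

lemma bdd_above_op_norm:
  assumes X: "finite X"
  shows "bdd_above ((\<lambda>\<psi>. vec_norm X (apply_op X A \<psi>)) ` {\<psi>. vec_norm X \<psi> \<le> 1})"
proof (rule bdd_aboveI2)
  fix \<psi> assume "\<psi> \<in> {\<psi>. vec_norm X \<psi> \<le> 1}"
  then have *: "cmod (\<psi> y) \<le> 1" if "y \<in> X" for y
    using member_le_L2_set[OF X that, of "\<lambda>y. cmod (\<psi> y)"] by (simp add: vec_norm_def)
  have "vec_norm X (apply_op X A \<psi>) \<le> (\<Sum>x\<in>X. cmod (apply_op X A \<psi> x))"
    unfolding vec_norm_def by (rule L2_set_le_sum) simp
  also have "\<dots> \<le> (\<Sum>x\<in>X. \<Sum>y\<in>X. cmod (A x y))"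
    unfolding apply_op_def
    by (intro sum_mono sum_norm_le) (auto simp: norm_mult intro: mult_left_le *)
  finally show "vec_norm X (apply_op X A \<psi>) \<le> (\<Sum>x\<in>X. \<Sum>y\<in>X. cmod (A x y))" .
qed

lemma op_norm_nonneg: "finite X \<Longrightarrow> 0 \<le> op_norm X A"
  unfolding op_norm_def
  by (rule cSUP_upper2[OF bdd_above_op_norm, of _ "\<lambda>_. 0"]) (auto simp: vec_norm_def L2_set_def sum_nonneg)

text \<open>For a unit vector this is Cauchy-Schwarz; scaling gives the general case.\<close>

lemma expect_le_op_norm:
  assumes X: "finite X"
  shows "expect X A \<psi> \<le> op_norm X A * norm_sq X \<psi>"
proof (cases "norm_sq X \<psi> = 0")
  case True
  then have "expect X A \<psi> = 0"
    using X by (simp add: norm_sq_eq_0_iff expect_def inner_on_def)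
  with True show ?thesis by simp
next
  case False
  then have N: "0 < norm_sq X \<psi>" using norm_sq_nonneg[of X \<psi>] by simp
  define c :: complex where "c = of_real (1 / sqrt (norm_sq X \<psi>))"
  define \<phi> where "\<phi> = (\<lambda>x. c * \<psi> x)"
  have c: "(cmod c)\<^sup>2 = 1 / norm_sq X \<psi>"
    using N by (simp add: c_def power_divide norm_divide)
  have "norm_sq X \<phi> = 1" using N by (simp add: \<phi>_def norm_sq_scale c)
  then have "(vec_norm X \<phi>)\<^sup>2 = 1" by (simp add: vec_norm_square)
  then have v: "vec_norm X \<phi> = 1"
    by (simp add: vec_norm_def power2_eq_1_iff) (smt (verit) L2_set_nonneg)
  have "expect X A \<phi> \<le> (\<Sum>x\<in>X. \<bar>cmod (\<phi> x)\<bar> * \<bar>cmod (apply_op X A \<phi> x)\<bar>)"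
    unfolding expect_def inner_on_def
    by (rule order_trans[OF complex_Re_le_cmod sum_norm_le]) (simp add: norm_mult)
  also have "\<dots> \<le> vec_norm X \<phi> * vec_norm X (apply_op X A \<phi>)"
    unfolding vec_norm_def by (rule L2_set_mult_ineq)
  also have "\<dots> \<le> op_norm X A"
    unfolding op_norm_def v mult_1 using v by (intro cSUP_upper bdd_above_op_norm[OF X]) simp
  finally show ?thesis
    using N by (simp add: \<phi>_def expect_scale c field_simps)
qed

section \<open>Operators embedded into a larger set of sites\<close>

text \<open>The cube in \<open>local_op\<close> becomes an arbitrary site set \<open>C\<close>, so
  that a whole patch Hamiltonian can be placed on the torus as well.\<close>

definition embed_op ::
  "site set \<Rightarrow> site set \<Rightarrow> (site \<Rightarrow> site) \<Rightarrow> (site \<Rightarrow> nat) kernel \<Rightarrow> (site \<Rightarrow> nat) kernel" where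
  "embed_op C S f A = (\<lambda>x y.
     if \<forall>s \<in> S - f ` C. x s = y s then A (\<lambda>a\<in>C. x (f a)) (\<lambda>a\<in>C. y (f a)) else 0)"

lemma local_op_eq_embed: "local_op D S f h = embed_op (cube D) S f h"
  unfolding local_op_def embed_op_def ..

lemma embed_sum:
  "embed_op C S f (\<lambda>x y. \<Sum>j\<in>J. A j x y) = (\<lambda>x y. \<Sum>j\<in>J. embed_op C S f (A j) x y)"
proof (intro ext)
  fix x y :: "site \<Rightarrow> nat"
  show "embed_op C S f (\<lambda>x y. \<Sum>j\<in>J. A j x y) x y = (\<Sum>j\<in>J. embed_op C S f (A j) x y)"
  proof (cases "\<forall>s\<in>S - f ` C. x s = y s")
    case True
    show ?thesis unfolding embed_op_def if_P[OF True] ..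
  next
    case False
    show ?thesis unfolding embed_op_def if_not_P[OF False] by simp
  qed
qed

text \<open>Agreement outside the image of \<open>T\<close>, together with agreement inside it but
  off the image of \<open>C\<close>, amounts to agreement off the image of \<open>C\<close> in
  \<open>S\<close>. Injectivity of \<open>g\<close> keeps those two parts of \<open>S\<close> apart.
  This turns a term of a placed patch into a term on the torus.\<close>

lemma embed_embed:
  assumes g: "inj_on g T" "g ` T \<subseteq> S" and f: "f ` C \<subseteq> T"
  shows "embed_op T S g (embed_op C T f A) = embed_op C S (g \<circ> f) A"
proof (intro ext)
  fix x y :: "site \<Rightarrow> nat"
  have "(\<forall>s\<in>S - g ` T. x s = y s) \<and> (\<forall>b\<in>T - f ` C. x (g b) = y (g b))
      \<longleftrightarrow> (\<forall>s\<in>S - (g \<circ> f) ` C. x s = y s)" (is "?L \<longleftrightarrow> ?R")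
  proof
    assume L: ?L
    show ?R
    proof
      fix s assume s: "s \<in> S - (g \<circ> f) ` C"
      show "x s = y s"
      proof (cases "s \<in> g ` T")
        case True
        then obtain b where "b \<in> T" "s = g b" by blast
        moreover from this s have "b \<notin> f ` C" by auto
        ultimately show ?thesis using L by blast
      next
        case False
        then show ?thesis using L s by blast
      qed
    qed
  next
    assume R: ?R
    have "g b \<in> S - (g \<circ> f) ` C" if "b \<in> T - f ` C" for b
      using that g f by (auto dest: inj_onD)
    moreover have "S - g ` T \<subseteq> S - (g \<circ> f) ` C" using f by auto
    ultimately show ?L using R by blast
  qed
  moreover have "(\<lambda>a\<in>C. (\<lambda>b\<in>T. x (g b)) (f a)) = (\<lambda>a\<in>C. x ((g \<circ> f) a))" for x :: "site \<Rightarrow> nat"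
    using f by (auto simp: restrict_def fun_eq_iff)
  ultimately show "embed_op T S g (embed_op C T f A) x y = embed_op C S (g \<circ> f) A x y"
    unfolding embed_op_def by (auto simp del: comp_apply)
qed

lemma pullback_configs:
  assumes "x \<in> configs d S" "f ` C \<subseteq> S"
  shows "(\<lambda>a\<in>C. x (f a)) \<in> configs d C"
  using assms by (auto simp: configs_def PiE_iff)

lemma hermitian_embed:
  assumes A: "hermitian_op (configs d C) A" and f: "f ` C \<subseteq> S"
  shows "hermitian_op (configs d S) (embed_op C S f A)"
  unfolding hermitian_op_def
proof (intro ballI)
  fix x y assume "x \<in> configs d S" "y \<in> configs d S"
  then have *: "A (\<lambda>a\<in>C. x (f a)) (\<lambda>a\<in>C. y (f a)) = cnj (A (\<lambda>a\<in>C. y (f a)) (\<lambda>a\<in>C. x (f a)))"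
    using A f pullback_configs unfolding hermitian_op_def by blast
  show "embed_op C S f A x y = cnj (embed_op C S f A y x)"
  proof (cases "\<forall>s\<in>S - f ` C. x s = y s")
    case True
    then have sym: "\<forall>s\<in>S - f ` C. y s = x s" by simp
    show ?thesis unfolding embed_op_def if_P[OF True] if_P[OF sym] by (rule *)
  next
    case False
    then have sym: "\<not> (\<forall>s\<in>S - f ` C. y s = x s)" by (simp add: eq_commute)
    show ?thesis unfolding embed_op_def if_not_P[OF False] if_not_P[OF sym] by simp
  qed
qed

lemma hermitian_sum:
  assumes "\<And>j. j \<in> J \<Longrightarrow> hermitian_op X (A j)"
  shows "hermitian_op X (\<lambda>x y. \<Sum>j\<in>J. A j x y)"
  unfolding hermitian_op_def
proof (intro ballI)
  fix x y assume "x \<in> X" "y \<in> X"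
  then have "A j x y = cnj (A j y x)" if "j \<in> J" for j
    using assms[OF that] unfolding hermitian_op_def by blast
  then show "(\<Sum>j\<in>J. A j x y) = cnj (\<Sum>j\<in>J. A j y x)"
    unfolding cnj_sum by (rule sum.cong[OF refl])
qed

lemma finite_configs: "finite S \<Longrightarrow> finite (configs d S)"
  by (simp add: configs_def finite_PiE)

lemma configs_nonempty: "1 \<le> d \<Longrightarrow> configs d S \<noteq> {}"
  by (auto simp: configs_def PiE_eq_empty_iff lessThan_empty_iff)

section \<open>Factoring the space over \<open>S\<close> into an embedded region and its
  complement\<close>

text \<open>On basis vectors this is the identification of the space over \<open>S\<close> with the
  tensor product of the space over \<open>C\<close> (placed by \<open>f\<close>) and the space over
  the remaining sites.\<close>

definition merge_config ::
  "site set \<Rightarrow> (site \<Rightarrow> site) \<Rightarrow> (site \<Rightarrow> nat) \<Rightarrow> (site \<Rightarrow> nat) \<Rightarrow> site \<Rightarrow> nat" where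
  "merge_config C f v z = (\<lambda>s. if s \<in> f ` C then v (the_inv_into C f s) else z s)"

context
  fixes C S :: "site set" and f :: "site \<Rightarrow> site" and d :: nat
  assumes inj: "inj_on f C" and sub: "f ` C \<subseteq> S"
begin

lemma merge_config_pullback:
  "v \<in> configs d C \<Longrightarrow> (\<lambda>a\<in>C. merge_config C f v z (f a)) = v"
  using inj by (auto simp: merge_config_def configs_def the_inv_into_f_f fun_eq_iff PiE_iff
      extensional_def restrict_def)

lemma merge_config_restrict:
  "z \<in> configs d (S - f ` C) \<Longrightarrow> restrict (merge_config C f v z) (S - f ` C) = z"
  by (auto simp: merge_config_def configs_def fun_eq_iff PiE_iff extensional_def restrict_def)

lemma bij_betw_merge_config:
  "bij_betw (\<lambda>(v, z). merge_config C f v z) (configs d C \<times> configs d (S - f ` C)) (configs d S)"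
proof (rule bij_betw_byWitness[where f' = "\<lambda>x. ((\<lambda>a\<in>C. x (f a)), restrict x (S - f ` C))"])
  show "(\<lambda>(v, z). merge_config C f v z) ` (configs d C \<times> configs d (S - f ` C)) \<subseteq> configs d S"
  proof clarify
    fix v z assume "v \<in> configs d C" "z \<in> configs d (S - f ` C)"
    then show "merge_config C f v z \<in> configs d S"
      using inj sub by (auto simp: merge_config_def configs_def the_inv_into_f_f PiE_iff extensional_def)
  qed
  show "\<forall>x\<in>configs d S. (\<lambda>(v, z). merge_config C f v z) ((\<lambda>a\<in>C. x (f a)), restrict x (S - f ` C)) = x"
    using inj sub by (auto simp: merge_config_def configs_def the_inv_into_f_f fun_eq_iff PiE_iff
        extensional_def restrict_def)
  show "(\<lambda>x. ((\<lambda>a\<in>C. x (f a)), restrict x (S - f ` C))) ` configs d S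
      \<subseteq> configs d C \<times> configs d (S - f ` C)"
    using sub by (auto simp: configs_def PiE_iff)
qed (auto simp: merge_config_pullback merge_config_restrict)

lemma sum_configs_merge:
  "(\<Sum>x\<in>configs d S. F x)
    = (\<Sum>z\<in>configs d (S - f ` C). \<Sum>v\<in>configs d C. F (merge_config C f v z))"
proof -
  have "(\<Sum>x\<in>configs d S. F x)
      = (\<Sum>p\<in>configs d C \<times> configs d (S - f ` C). F (case p of (v, z) \<Rightarrow> merge_config C f v z))"
    by (rule sum.reindex_bij_betw[OF bij_betw_merge_config, symmetric])
  also have "\<dots> = (\<Sum>v\<in>configs d C. \<Sum>z\<in>configs d (S - f ` C). F (merge_config C f v z))"
    by (simp add: sum.cartesian_product split_def)
  finally show ?thesis
    by (subst sum.swap)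
qed

text \<open>In the tensor factorisation the embedded operator is \<open>A\<close> times the
  identity, hence block diagonal in the outside configuration.\<close>

lemma embed_merge:
  assumes "v \<in> configs d C" "v' \<in> configs d C" "z \<in> configs d (S - f ` C)" "z' \<in> configs d (S - f ` C)"
  shows "embed_op C S f A (merge_config C f v z) (merge_config C f v' z') = (if z = z' then A v v' else 0)"
proof -
  have "(\<forall>s\<in>S - f ` C. merge_config C f v z s = merge_config C f v' z' s)
      \<longleftrightarrow> (\<forall>s\<in>S - f ` C. z s = z' s)"
    by (simp add: merge_config_def)
  also have "\<dots> \<longleftrightarrow> z = z'"
    using PiE_ext[OF assms(3,4)[unfolded configs_def]] by blast
  finally show ?thesis
    using assms by (simp add: embed_op_def merge_config_pullback)
qed

lemma norm_sq_merge:
  "norm_sq (configs d S) \<psi>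
    = (\<Sum>z\<in>configs d (S - f ` C). norm_sq (configs d C) (\<lambda>v. \<psi> (merge_config C f v z)))"
  unfolding norm_sq_def by (rule sum_configs_merge)

text \<open>Block diagonality decouples the form into one copy of the form of \<open>A\<close> for
  each slice of \<open>\<psi>\<close> at a fixed outside configuration \<open>z\<close>.\<close>

lemma expect_embed:
  assumes S: "finite S"
  shows "expect (configs d S) (embed_op C S f A) \<psi>
    = (\<Sum>z\<in>configs d (S - f ` C). expect (configs d C) A (\<lambda>v. \<psi> (merge_config C f v z)))"
proof -
  have "apply_op (configs d S) (embed_op C S f A) \<psi> (merge_config C f v z)
      = apply_op (configs d C) A (\<lambda>v. \<psi> (merge_config C f v z)) v"
    if v: "v \<in> configs d C" and z: "z \<in> configs d (S - f ` C)" for v z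
  proof -
    have "apply_op (configs d S) (embed_op C S f A) \<psi> (merge_config C f v z)
      = (\<Sum>z'\<in>configs d (S - f ` C). \<Sum>v'\<in>configs d C.
          (if z = z' then A v v' else 0) * \<psi> (merge_config C f v' z'))"
      unfolding apply_op_def
      by (rule trans[OF sum_configs_merge]) (intro sum.cong refl, simp only: embed_merge[OF v _ z])
    also have "\<dots> = (\<Sum>z'\<in>configs d (S - f ` C). if z = z' then
        \<Sum>v'\<in>configs d C. A v v' * \<psi> (merge_config C f v' z) else 0)"
      by (rule sum.cong) auto
    also have "\<dots> = apply_op (configs d C) A (\<lambda>v. \<psi> (merge_config C f v z)) v"
      using z S by (simp add: apply_op_def finite_configs)
    finally show ?thesis .
  qed
  then have "inner_on (configs d S) \<psi> (apply_op (configs d S) (embed_op C S f A) \<psi>)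
      = (\<Sum>z\<in>configs d (S - f ` C). inner_on (configs d C) (\<lambda>v. \<psi> (merge_config C f v z))
          (apply_op (configs d C) A (\<lambda>v. \<psi> (merge_config C f v z))))"
    unfolding inner_on_def
    by (intro trans[OF sum_configs_merge] sum.cong refl) simp
  then show ?thesis
    by (simp add: expect_def)
qed

text \<open>Tensoring with the identity preserves a lower bound on the form: it applies to each
  slice, and squared norms of slices add up.\<close>

lemma expect_embed_ge:
  assumes "finite S" "\<And>\<phi>. l * norm_sq (configs d C) \<phi> \<le> expect (configs d C) A \<phi>"
  shows "l * norm_sq (configs d S) \<psi> \<le> expect (configs d S) (embed_op C S f A) \<psi>"
  unfolding expect_embed[OF assms(1)] norm_sq_merge sum_distrib_left by (rule sum_mono) (rule assms(2))

lemma expect_embed_le: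
  assumes "finite S" "\<And>\<phi>. expect (configs d C) A \<phi> \<le> u * norm_sq (configs d C) \<phi>"
  shows "expect (configs d S) (embed_op C S f A) \<psi> \<le> u * norm_sq (configs d S) \<psi>"
  unfolding expect_embed[OF assms(1)] norm_sq_merge sum_distrib_left by (rule sum_mono) (rule assms(2))

text \<open>Every slice of a product vector is a scalar multiple of \<open>\<phi>\<close>, so its
  energy is \<open>l\<close> times its squared norm whatever the scalar. Neither factor has to be
  normalised.\<close>

lemma expect_embed_product:
  assumes S: "finite S"
    and \<psi>: "\<And>x. x \<in> configs d S \<Longrightarrow> \<psi> x = \<rho> (restrict x (S - f ` C)) * \<phi> (\<lambda>a\<in>C. x (f a))"
    and \<phi>: "expect (configs d C) A \<phi> = l * norm_sq (configs d C) \<phi>"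
  shows "expect (configs d S) (embed_op C S f A) \<psi> = l * norm_sq (configs d S) \<psi>"
proof -
  have merge: "\<psi> (merge_config C f v z) = \<rho> z * \<phi> v"
    if "v \<in> configs d C" "z \<in> configs d (S - f ` C)" for v z
    using \<psi>[of "merge_config C f v z"] bij_betwE[OF bij_betw_merge_config] that
    by (auto simp: merge_config_pullback merge_config_restrict)
  have "expect (configs d C) A (\<lambda>v. \<psi> (merge_config C f v z))
      = l * norm_sq (configs d C) (\<lambda>v. \<psi> (merge_config C f v z))"
    if z: "z \<in> configs d (S - f ` C)" for z
  proof -
    have "expect (configs d C) A (\<lambda>v. \<psi> (merge_config C f v z)) = expect (configs d C) A (\<lambda>v. \<rho> z * \<phi> v)"
      using merge z by (intro expect_cong) simp
    moreover have "norm_sq (configs d C) (\<lambda>v. \<psi> (merge_config C f v z)) = norm_sq (configs d C) (\<lambda>v. \<rho> z * \<phi> v)"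
      using merge z by (intro norm_sq_cong) simp
    ultimately show ?thesis
      using \<phi> by (simp add: expect_scale norm_sq_scale)
  qed
  then show ?thesis
    unfolding expect_embed[OF S] norm_sq_merge sum_distrib_left by (rule sum.cong[OF refl])
qed

end

section \<open>Translated patches on the torus\<close>

lemma finite_grid: "finite I \<Longrightarrow> finite (grid D I)"
  by (simp add: grid_def finite_PiE)

lemma card_grid: "finite I \<Longrightarrow> card (grid D I) = card I ^ D"
  by (simp add: grid_def card_PiE)

lemma grid_mem: "s \<in> grid D I \<Longrightarrow> i < D \<Longrightarrow> s i \<in> I"
  by (auto simp: grid_def)

lemma grid_eqI: "s \<in> grid D I \<Longrightarrow> t \<in> grid D J \<Longrightarrow> (\<And>i. i < D \<Longrightarrow> s i = t i) \<Longrightarrow> s = t"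
  unfolding grid_def PiE_iff by (auto intro: extensionalityI)

lemma translate_mod_mem: "1 \<le> n \<Longrightarrow> translate_mod D n q a \<in> torus D n"
  by (auto simp: translate_mod_def grid_def)

lemma translate_mem: "j \<in> grid D {1..m-1} \<Longrightarrow> a \<in> cube D \<Longrightarrow> translate D j a \<in> patch D m"
  by (force simp: translate_def grid_def PiE_iff)

text \<open>Positions inside a patch are added without reduction; reducing only at the end shows
  that shifting the patch by \<open>q\<close> shifts the roots of its terms by
  \<open>q\<close>.\<close>

lemma translate_mod_translate:
  "translate_mod D n q (translate D j a) = translate_mod D n (translate_mod D n q j) a"
  by (auto simp: translate_mod_def translate_def fun_eq_iff restrict_def mod_simps add.assoc)

lemma translate_mod_commute: "translate_mod D n q j = translate_mod D n j q"
  by (simp add: translate_mod_def add.commute)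

lemma inj_on_translate_mod:
  assumes "inj_on (\<lambda>a. a mod n) I"
  shows "inj_on (translate_mod D n q) (grid D I)"
proof (rule inj_onI)
  fix s t assume st: "s \<in> grid D I" "t \<in> grid D I" and eq: "translate_mod D n q s = translate_mod D n q t"
  show "s = t"
  proof (rule grid_eqI[OF st])
    fix i assume i: "i < D"
    have "(q i + s i) mod n = (q i + t i) mod n"
      using fun_cong[OF eq, of i] i by (simp add: translate_mod_def)
    \<comment> \<open>Cancelling \<open>q i\<close> is a subtraction of congruences, carried out
      over the integers because subtraction on \<open>nat\<close> truncates.\<close>
    then have "int (q i + s i) mod int n = int (q i + t i) mod int n"
      by (simp only: of_nat_mod[symmetric])
    from mod_diff_cong[OF this refl, of "int (q i)"] have "s i mod n = t i mod n"
      by (simp flip: of_nat_mod)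
    then show "s i = t i"
      using assms grid_mem[OF st(1) i] grid_mem[OF st(2) i] by (auto dest: inj_onD)
  qed
qed

text \<open>Patch coordinates start at 1, so for a patch as wide as the torus the residue 0 is
  represented by \<open>n\<close>.\<close>

lemma inj_on_mod_atLeastAtMost: "inj_on (\<lambda>a. a mod n) {1..n::nat}"
proof (rule inj_onI)
  fix a b assume "a \<in> {1..n}" "b \<in> {1..n}" "a mod n = b mod n"
  then show "a = b"
    by (cases "a = n"; cases "b = n") auto
qed

text \<open>Root and offset enter symmetrically, so injectivity in the offset is injectivity in the
  root; an injective self-map of a finite set is onto.\<close>

lemma bij_betw_translate_mod:
  assumes "1 \<le> n"
  shows "bij_betw (\<lambda>q. translate_mod D n q j) (torus D n) (torus D n)"
proof -
  have "inj_on (translate_mod D n j) (torus D n)"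
    by (rule inj_on_translate_mod) (auto simp: inj_on_def)
  moreover have "translate_mod D n j ` torus D n \<subseteq> torus D n"
    using translate_mod_mem[OF assms] by blast
  ultimately have "bij_betw (translate_mod D n j) (torus D n) (torus D n)"
    using endo_inj_surj[of "torus D n"] by (simp add: bij_betw_def finite_grid)
  then show ?thesis
    by (simp add: translate_mod_commute[of D n _ j])
qed

lemma inj_on_translate_mod_patch: "m \<le> n \<Longrightarrow> inj_on (translate_mod D n q) (patch D m)"
  by (rule inj_on_translate_mod, rule inj_on_subset[OF inj_on_mod_atLeastAtMost]) auto

lemma inj_on_translate_mod_cube: "2 \<le> n \<Longrightarrow> inj_on (translate_mod D n q) (cube D)"
  by (rule inj_on_translate_mod) (auto simp: inj_on_def)

section \<open>Lower bound: averaging over all patch positions\<close>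

definition term_op :: "nat \<Rightarrow> (site \<Rightarrow> nat) kernel \<Rightarrow> nat \<Rightarrow> site \<Rightarrow> (site \<Rightarrow> nat) kernel" where
  "term_op D h n j = embed_op (cube D) (torus D n) (translate_mod D n j) h"

lemma H_periodic_eq: "H_periodic D h n = (\<lambda>x y. \<Sum>j\<in>torus D n. term_op D h n j x y)"
  unfolding H_periodic_def local_op_eq_embed term_op_def ..

text \<open>By \<open>embed_embed\<close>, each patch term becomes a torus term with shifted root;
  \<open>m \<le> n\<close> keeps the patch sites distinct on the torus.\<close>

lemma embed_h_patch:
  assumes "1 \<le> m" "m \<le> n"
  shows "embed_op (patch D m) (torus D n) (translate_mod D n q) (h_patch D h m)
    = (\<lambda>x y. \<Sum>j\<in>grid D {1..m-1}. term_op D h n (translate_mod D n q j) x y)"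
proof -
  have "embed_op (patch D m) (torus D n) (translate_mod D n q) (embed_op (cube D) (patch D m) (translate D j) h)
      = term_op D h n (translate_mod D n q j)" if j: "j \<in> grid D {1..m-1}" for j
  proof -
    have "embed_op (patch D m) (torus D n) (translate_mod D n q) (embed_op (cube D) (patch D m) (translate D j) h)
      = embed_op (cube D) (torus D n) (translate_mod D n q \<circ> translate D j) h"
      using assms translate_mod_mem[of n D] translate_mem[OF j]
      by (intro embed_embed inj_on_translate_mod_patch) auto
    then show ?thesis
      unfolding term_op_def by (simp add: comp_def translate_mod_translate)
  qed
  then show ?thesis
    unfolding h_patch_def local_op_eq_embed embed_sum by (intro ext sum.cong refl) simp
qed

lemma sum_expect_term_op_patch:
  assumes "1 \<le> m" "m \<le> n"
  shows "(\<Sum>j\<in>grid D {1..m-1}. expect X (term_op D h n (translate_mod D n q j)) \<psi>)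
    = expect X (embed_op (patch D m) (torus D n) (translate_mod D n q) (h_patch D h m)) \<psi>"
  unfolding embed_h_patch[OF assms] expect_sum ..

lemma hermitian_h_patch:
  assumes "hermitian_op (configs d (cube D)) h"
  shows "hermitian_op (configs d (patch D m)) (h_patch D h m)"
  unfolding h_patch_def local_op_eq_embed
  using translate_mem by (intro hermitian_sum hermitian_embed assms) blast

lemma hermitian_H_periodic:
  assumes "hermitian_op (configs d (cube D)) h" "1 \<le> n"
  shows "hermitian_op (configs d (torus D n)) (H_periodic D h n)"
  unfolding H_periodic_eq term_op_def
  using translate_mod_mem[OF assms(2)] by (intro hermitian_sum hermitian_embed assms) blast

lemma lambda_patch_bound:
  assumes "1 \<le> d" "hermitian_op (configs d (cube D)) h"
  shows "lambda_patch D d h m * norm_sq (configs d (patch D m)) \<phi>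
    \<le> expect (configs d (patch D m)) (h_patch D h m) \<phi>"
  unfolding lambda_patch_def
  using assms by (intro lambda_min_le finite_configs configs_nonempty hermitian_h_patch finite_grid) auto

text \<open>Evaluate all placed patch Hamiltonians in a ground state of the periodic one. Each
  placement costs at least the patch energy, and each torus term occurs once for every relative
  position \<open>j\<close> in a patch.\<close>

lemma lambda_periodic_ge:
  assumes d: "1 \<le> d" and h: "hermitian_op (configs d (cube D)) h" and m: "1 \<le> m" "m \<le> n"
  shows "lambda_patch D d h m * real n ^ D
    \<le> (real m - 1) ^ D * lambda_min (configs d (torus D n)) (H_periodic D h n)"
proof -
  let ?X = "configs d (torus D n)" and ?G = "grid D {1..m-1}" and ?T = "torus D n"
  have n: "1 \<le> n" using m by simp
  have fin: "finite ?T" "finite ?X" by (simp_all add: finite_grid finite_configs)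
  obtain \<psi> x where x: "x \<in> ?X" "\<psi> x \<noteq> 0"
    and \<psi>: "expect ?X (H_periodic D h n) \<psi> = lambda_min ?X (H_periodic D h n) * norm_sq ?X \<psi>"
    using lambda_min_attained[OF fin(2) configs_nonempty[OF d] hermitian_H_periodic[OF h n]] by blast
  have "lambda_patch D d h m * norm_sq ?X \<psi> * real n ^ D = (\<Sum>q\<in>?T. lambda_patch D d h m * norm_sq ?X \<psi>)"
    by (simp add: card_grid mult_ac)
  also have "\<dots> \<le> (\<Sum>q\<in>?T. \<Sum>j\<in>?G. expect ?X (term_op D h n (translate_mod D n q j)) \<psi>)"
  proof (rule sum_mono)
    fix q assume "q \<in> ?T"
    show "lambda_patch D d h m * norm_sq ?X \<psi> \<le> (\<Sum>j\<in>?G. expect ?X (term_op D h n (translate_mod D n q j)) \<psi>)"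
      unfolding sum_expect_term_op_patch[OF m]
      using m translate_mod_mem[OF n]
      by (intro expect_embed_ge inj_on_translate_mod_patch fin lambda_patch_bound d h) auto
  qed
  also have "\<dots> = (\<Sum>j\<in>?G. \<Sum>q\<in>?T. expect ?X (term_op D h n (translate_mod D n q j)) \<psi>)"
    by (rule sum.swap)
  \<comment> \<open>For fixed \<open>j\<close>, shifting by \<open>j\<close> permutes the torus, so
    the inner sum is the full periodic energy.\<close>
  also have "\<dots> = (\<Sum>j\<in>?G. \<Sum>q\<in>?T. expect ?X (term_op D h n q) \<psi>)"
    by (intro sum.cong refl sum.reindex_bij_betw[OF bij_betw_translate_mod[OF n]])
  also have "\<dots> = (real m - 1) ^ D * expect ?X (H_periodic D h n) \<psi>"
    unfolding H_periodic_eq expect_sum using m by (simp add: card_grid of_nat_diff)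
  finally show ?thesis
    using norm_sq_pos[OF fin(2) x(1), of \<psi>] x(2) by (simp add: \<psi> mult_ac)
qed

section \<open>Upper bound: a product trial state on disjoint patches\<close>

text \<open>Corners at multiples of \<open>m\<close> below \<open>m * (n div m)\<close> keep every
  unreduced coordinate in \<open>{1..n}\<close>, so nothing wraps around, and division by
  \<open>m\<close> recovers patch and offset: the patches are disjoint.\<close>

lemma inj_on_patch_positions:
  "inj_on (\<lambda>(q, a). translate_mod D n q a) (grid D ((*) m ` {..<n div m}) \<times> patch D m)"
proof (rule inj_onI, clarify)
  fix q a q' a'
  assume q: "q \<in> grid D ((*) m ` {..<n div m})" "q' \<in> grid D ((*) m ` {..<n div m})"
    and a: "a \<in> patch D m" "a' \<in> patch D m"
    and eq: "translate_mod D n q a = translate_mod D n q' a'"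
  have "q i = q' i \<and> a i = a' i" if i: "i < D" for i
  proof -
    obtain u u' where u: "q i = m * u" "u < n div m" "q' i = m * u'" "u' < n div m"
      using grid_mem[OF q(1) i] grid_mem[OF q(2) i] by blast
    have b: "1 \<le> a i" "a i \<le> m" "1 \<le> a' i" "a' i \<le> m"
      using grid_mem[OF a(1) i] grid_mem[OF a(2) i] by auto
    have range: "m * w + b \<in> {1..n}" if "w < n div m" "1 \<le> b" "b \<le> m" for w b
    proof -
      have "m * w + b \<le> m * Suc w" using that by simp
      also have "\<dots> \<le> m * (n div m)" using that by (intro mult_le_mono2) simp
      also have "\<dots> \<le> n" by simp
      finally show ?thesis using that by simp
    qed
    have "(q i + a i) mod n = (q' i + a' i) mod n"
      using fun_cong[OF eq, of i] i by (simp add: translate_mod_def)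
    then have "m * u + a i = m * u' + a' i"
      by (intro inj_onD[OF inj_on_mod_atLeastAtMost _ range[OF u(2) b(1,2)] range[OF u(4) b(3,4)]])
        (simp add: u)
    \<comment> \<open>Offsets run through 1 to \<open>m\<close>; subtracting 1 makes them remainders
      modulo \<open>m\<close>.\<close>
    then have *: "m * u + (a i - 1) = m * u' + (a' i - 1)" using b by linarith
    have "(m * w + c) div m = w" if "c < m" for w c
      using that by simp
    moreover have "a i - 1 < m" "a' i - 1 < m" using b by auto
    ultimately have "u = u'" using * by metis
    then show ?thesis using * u b by auto
  qed
  then show "q = q' \<and> a = a'"
    using grid_eqI q a by metis
qed

lemma lambda_periodic_le:
  fixes D d m n :: nat
  assumes d: "1 \<le> d" and h: "hermitian_op (configs d (cube D)) h" and m: "2 \<le> m" "m \<le> n"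
  defines "k \<equiv> n div m"
  shows "lambda_min (configs d (torus D n)) (H_periodic D h n)
    \<le> real k ^ D * lambda_patch D d h m
      + (real n ^ D - real k ^ D * (real m - 1) ^ D) * op_norm (configs d (cube D)) h"
proof -
  let ?X = "configs d (torus D n)" and ?G = "grid D {1..m-1}" and ?T = "torus D n"
    and ?P = "grid D ((*) m ` {..<k})" and ?Y = "configs d (patch D m)"
    and ?g = "translate_mod D n" and ?c = "op_norm (configs d (cube D)) h"
  have n: "1 \<le> n" "2 \<le> n" using m by auto
  have m1: "1 \<le> m" using m by simp
  have fin: "finite ?T" "finite ?X" "finite ?P" "finite ?Y" "finite ?G" "finite (patch D m)"
    by (simp_all add: finite_grid finite_configs)
  have inj: "inj_on (\<lambda>(q, a). ?g q a) (?P \<times> patch D m)"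
    unfolding k_def by (rule inj_on_patch_positions)
  have sub: "?g q ` A \<subseteq> ?T" for q A using translate_mod_mem[OF n(1)] by blast
  obtain \<phi> v where v: "v \<in> ?Y" "\<phi> v \<noteq> 0"
    and \<phi>: "expect ?Y (h_patch D h m) \<phi> = lambda_patch D d h m * norm_sq ?Y \<phi>"
    unfolding lambda_patch_def
    using lambda_min_attained[OF fin(4) configs_nonempty[OF d] hermitian_h_patch[OF h]] by blast
  \<comment> \<open>One factor \<open>\<phi>\<close> per patch and no dependence on uncovered sites,
    which are thus in an unnormalised uniform superposition.\<close>
  define \<psi> where "\<psi> x = (\<Prod>q\<in>?P. \<phi> (\<lambda>a\<in>patch D m. x (?g q a)))" for x :: "site \<Rightarrow> nat"

  \<comment> \<open>By disjointness, the factors of the other patches read only sites outside patch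
    \<open>q\<close>, so \<open>\<psi>\<close> is a product with respect to that patch.\<close>
  have patch_energy: "expect ?X (embed_op (patch D m) ?T (?g q) (h_patch D h m)) \<psi>
      = lambda_patch D d h m * norm_sq ?X \<psi>" if q: "q \<in> ?P" for q
  proof (rule expect_embed_product[OF inj_on_translate_mod_patch[OF m(2)] sub fin(1) _ \<phi>])
    fix x :: "site \<Rightarrow> nat"
    let ?R = "?T - ?g q ` patch D m"
    have "?g q' a \<in> ?R" if "q' \<in> ?P - {q}" "a \<in> patch D m" for q' a
      using inj_onD[OF inj, of "(q', a)" "(q, b)" for b] that q translate_mod_mem[OF n(1)] by auto
    then have "(\<lambda>a\<in>patch D m. x (?g q' a)) = (\<lambda>a\<in>patch D m. restrict x ?R (?g q' a))"
      if "q' \<in> ?P - {q}" for q'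
      using that by (intro restrict_ext) simp
    then have "(\<Prod>q'\<in>?P - {q}. \<phi> (\<lambda>a\<in>patch D m. x (?g q' a)))
        = (\<Prod>q'\<in>?P - {q}. \<phi> (\<lambda>a\<in>patch D m. restrict x ?R (?g q' a)))"
      by (intro prod.cong refl arg_cong[of _ _ \<phi>])
    then show "\<psi> x = (\<lambda>w. \<Prod>q'\<in>?P - {q}. \<phi> (\<lambda>a\<in>patch D m. w (?g q' a))) (restrict x ?R)
        * \<phi> (\<lambda>a\<in>patch D m. x (?g q a))"
      unfolding \<psi>_def prod.remove[OF fin(3) q] by (simp only: mult.commute)
  qed

  have "0 < norm_sq ?X \<psi>"
  proof -
    define pos where "pos = the_inv_into (?P \<times> patch D m) (\<lambda>(q, a). ?g q a)"
    \<comment> \<open>Copying \<open>v\<close> into every patch makes all factors equal to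
      \<open>\<phi> v\<close>, which is nonzero. The filler 0 is a legal basis state because
      \<open>d\<close> is positive.\<close>
    define x where "x = (\<lambda>s\<in>?T. if s \<in> (\<lambda>(q, a). ?g q a) ` (?P \<times> patch D m) then v (snd (pos s)) else 0)"
    have pos: "pos (?g q a) = (q, a)" if "q \<in> ?P" "a \<in> patch D m" for q a
      using the_inv_into_f_f[OF inj, of "(q, a)"] that by (simp add: pos_def)
    have "v a < d" if "a \<in> patch D m" for a
      using v that by (auto simp: configs_def PiE_iff)
    then have x: "x \<in> ?X"
      using d by (auto simp: x_def configs_def pos)
    have "(\<lambda>a\<in>patch D m. x (?g q a)) = v" if q: "q \<in> ?P" for q
    proof
      fix a
      show "(\<lambda>a\<in>patch D m. x (?g q a)) a = v a"
      proof (cases "a \<in> patch D m")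
        case True
        then have "?g q a \<in> (\<lambda>(q, a). ?g q a) ` (?P \<times> patch D m)" using q by force
        then show ?thesis
          using True q translate_mod_mem[OF n(1)] by (simp add: x_def pos)
      next
        case False
        then show ?thesis using v by (auto simp: configs_def PiE_iff extensional_def)
      qed
    qed
    then have "\<psi> x \<noteq> 0"
      unfolding \<psi>_def using v fin(3) by simp
    then show ?thesis
      by (rule norm_sq_pos[OF fin(2) x])
  qed

  \<comment> \<open>Roots of the terms contained in a single placed patch; being sites of disjoint
    patches, they are distinct for distinct pairs.\<close>
  define J where "J = (\<lambda>(q, j). ?g q j) ` (?P \<times> ?G)"
  have inj_J: "inj_on (\<lambda>(q, j). ?g q j) (?P \<times> ?G)"
  proof (rule inj_on_subset[OF inj])
    show "?P \<times> ?G \<subseteq> ?P \<times> patch D m"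
      unfolding grid_def by (intro Sigma_mono subset_refl PiE_mono) auto
  qed
  have J: "J \<subseteq> ?T" using sub by (auto simp: J_def)
  have card_P: "card ?P = k ^ D"
    using m1 by (simp add: card_grid card_image inj_on_def)
  have card_J: "card J = k ^ D * (m - 1) ^ D"
    unfolding J_def card_image[OF inj_J] card_cartesian_product card_P by (simp add: card_grid)
  have "card (?T - J) = n ^ D - k ^ D * (m - 1) ^ D"
    using card_Diff_subset[OF finite_subset[OF J fin(1)] J] by (simp add: card_grid card_J)
  \<comment> \<open>This makes the natural-number subtraction exact, so it carries over to the
    reals.\<close>
  moreover have "k ^ D * (m - 1) ^ D \<le> n ^ D"
    using card_mono[OF fin(1) J] by (simp add: card_grid card_J)
  ultimately have card_rest: "real (card (?T - J)) = real n ^ D - real k ^ D * (real m - 1) ^ D"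
    using m1 by (simp add: of_nat_diff)

  have "(\<Sum>j\<in>J. expect ?X (term_op D h n j) \<psi>)
      = (\<Sum>q\<in>?P. \<Sum>j\<in>?G. expect ?X (term_op D h n (?g q j)) \<psi>)"
    unfolding J_def sum.reindex[OF inj_J] sum.cartesian_product by (simp add: split_def comp_def)
  also have "\<dots> = (\<Sum>q\<in>?P. lambda_patch D d h m * norm_sq ?X \<psi>)"
    unfolding sum_expect_term_op_patch[OF m1 m(2)] by (rule sum.cong[OF refl patch_energy])
  also have "\<dots> = real k ^ D * lambda_patch D d h m * norm_sq ?X \<psi>"
    by (simp add: card_P)
  finally have inner: "(\<Sum>j\<in>J. expect ?X (term_op D h n j) \<psi>)
      = real k ^ D * lambda_patch D d h m * norm_sq ?X \<psi>" .
  \<comment> \<open>The bound holds for every term; it is applied to those not contained in a single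
    placed patch.\<close>
  have "expect ?X (term_op D h n j) \<psi> \<le> ?c * norm_sq ?X \<psi>" for j
    unfolding term_op_def
    by (intro expect_embed_le inj_on_translate_mod_cube n sub fin expect_le_op_norm finite_configs finite_grid) simp
  then have "(\<Sum>j\<in>?T - J. expect ?X (term_op D h n j) \<psi>) \<le> of_nat (card (?T - J)) * (?c * norm_sq ?X \<psi>)"
    by (intro sum_bounded_above)
  moreover have "expect ?X (H_periodic D h n) \<psi> = (\<Sum>j\<in>?T - J. expect ?X (term_op D h n j) \<psi>)
      + (\<Sum>j\<in>J. expect ?X (term_op D h n j) \<psi>)"
    unfolding H_periodic_eq expect_sum by (rule sum.subset_diff[OF J fin(1)])
  ultimately have "expect ?X (H_periodic D h n) \<psi>
      \<le> (real k ^ D * lambda_patch D d h m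
        + (real n ^ D - real k ^ D * (real m - 1) ^ D) * ?c) * norm_sq ?X \<psi>"
    unfolding inner card_rest by (simp add: algebra_simps)
  then have "lambda_min ?X (H_periodic D h n) * norm_sq ?X \<psi>
      \<le> (real k ^ D * lambda_patch D d h m
        + (real n ^ D - real k ^ D * (real m - 1) ^ D) * ?c) * norm_sq ?X \<psi>"
    using lambda_min_le[OF fin(2) configs_nonempty[OF d] hermitian_H_periodic[OF h n(1)], of \<psi>] by linarith
  then show ?thesis
    using \<open>0 < norm_sq ?X \<psi>\<close> by simp
qed

section \<open>The infinite-volume limit\<close>

text \<open>Rounding down costs less than 1, hence less than \<open>1 / n\<close> after division by
  \<open>n\<close>.\<close>

lemma tendsto_div_over:
  assumes "0 < m"
  shows "(\<lambda>n. real (n div m) / real n) \<longlonglongrightarrow> 1 / real m"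
proof (rule tendsto_sandwich)
  show "\<forall>\<^sub>F n in sequentially. 1 / real m - 1 / real n \<le> real (n div m) / real n"
  proof (rule eventually_mono[OF eventually_gt_at_top[of 0]])
    fix n :: nat assume n: "0 < n"
    have "n = m * (n div m) + n mod m" by simp
    also have "\<dots> \<le> m * (n div m) + m" using assms by (intro add_left_mono less_imp_le mod_less_divisor)
    finally have "real n \<le> real m * real (n div m) + real m" by (simp flip: of_nat_mult of_nat_add)
    then have "real n / real m \<le> real (n div m) + 1"
      using assms by (simp add: field_simps)
    from divide_right_mono[OF this, of "real n"] show "1 / real m - 1 / real n \<le> real (n div m) / real n"
      using n by (simp add: add_divide_distrib)
  qed
  show "\<forall>\<^sub>F n in sequentially. real (n div m) / real n \<le> 1 / real m"
  proof (rule eventually_mono[OF eventually_gt_at_top[of 0]])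
    fix n :: nat assume n: "0 < n"
    have "real (n div m) \<le> real n / real m" by (rule of_nat_div_le_of_nat)
    then show "real (n div m) / real n \<le> 1 / real m"
      using n assms by (simp add: field_simps)
  qed
  show "(\<lambda>n. 1 / real m - 1 / real n) \<longlonglongrightarrow> 1 / real m"
    using tendsto_diff[OF tendsto_const lim_1_over_n] by simp
qed simp

theorem proposition1:
  fixes D d m :: nat and h :: "(site \<Rightarrow> nat) kernel"
  assumes "D \<ge> 1" and "d \<ge> 1" and "m \<ge> 2"
    and "hermitian_op (configs d (cube D)) h"
  shows "ereal (anderson_bound D d h m) \<le> e_min D d h \<and>
    \<bar>e_min D d h - ereal (anderson_bound D d h m)\<bar>
      \<le> ereal (real D / real m * op_norm (configs d (cube D)) h
          - lambda_patch D d h m * (1 / (real m - 1) ^ D - 1 / real m ^ D))"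
proof -
  let ?l = "lambda_patch D d h m" and ?c = "op_norm (configs d (cube D)) h"
  have m: "0 < real m" "0 < real m - 1" using \<open>m \<ge> 2\<close> by auto
  have lower: "anderson_bound D d h m \<le> energy_density D d h n" if "m \<le> n" for n
  proof -
    have "?l * real n ^ D \<le> (real m - 1) ^ D * lambda_min (configs d (torus D n)) (H_periodic D h n)"
      using assms that by (intro lambda_periodic_ge) auto
    moreover have "0 < real n ^ D" using that \<open>m \<ge> 2\<close> by simp
    ultimately show ?thesis
      using m by (simp add: anderson_bound_def energy_density_def field_simps)
  qed
  \<comment> \<open>The bound of \<open>lambda_periodic_le\<close> per site; \<open>U\<close> below
    is its limit, with the ratio replaced by \<open>1 / m\<close>.\<close>
  define u where "u n = (real (n div m) / real n) ^ D * ?l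
    + (1 - (real (n div m) / real n) ^ D * (real m - 1) ^ D) * ?c" for n
  define U where "U = (1 / real m) ^ D * ?l + (1 - (1 / real m) ^ D * (real m - 1) ^ D) * ?c"
  have upper: "energy_density D d h n \<le> u n" if "m \<le> n" for n
  proof -
    have "lambda_min (configs d (torus D n)) (H_periodic D h n)
      \<le> real (n div m) ^ D * ?l + (real n ^ D - real (n div m) ^ D * (real m - 1) ^ D) * ?c"
      using assms that by (intro lambda_periodic_le) auto
    moreover have "0 < real n ^ D" using that \<open>m \<ge> 2\<close> by simp
    ultimately show ?thesis
      by (simp add: u_def energy_density_def field_simps)
  qed
  have "u \<longlonglongrightarrow> U"
    unfolding u_def U_def using \<open>m \<ge> 2\<close> by (intro tendsto_intros tendsto_div_over) auto
  then have "limsup (\<lambda>n. ereal (u n)) = ereal U"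
    by (intro lim_imp_Limsup tendsto_ereal) auto
  moreover have "e_min D d h \<le> limsup (\<lambda>n. ereal (u n))"
    unfolding e_min_def
    by (rule Limsup_mono) (use upper in \<open>auto simp: eventually_sequentially\<close>)
  ultimately have e_le: "e_min D d h \<le> ereal U" by simp
  have e_ge: "ereal (anderson_bound D d h m) \<le> e_min D d h"
  proof -
    have "ereal (anderson_bound D d h m) = limsup (\<lambda>n::nat. ereal (anderson_bound D d h m))"
      by (simp add: Limsup_const)
    also have "\<dots> \<le> e_min D d h"
      unfolding e_min_def
      by (rule Limsup_mono) (use lower in \<open>auto simp: eventually_sequentially\<close>)
    finally show ?thesis .
  qed
  \<comment> \<open>Lying between two reals, the limit superior is finite, and the rest is real
    arithmetic.\<close>
  obtain e where e: "e_min D d h = ereal e"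
    using e_le e_ge by (cases "e_min D d h") auto
  \<comment> \<open>In the limit, a fraction \<open>(1 - 1 / m) ^ D\<close> of all terms lies inside
    patches; by Bernoulli the remaining fraction is at most \<open>D / m\<close>.\<close>
  have "1 - real D / real m \<le> (1 - 1 / real m) ^ D"
    using Bernoulli_inequality[of "- (1 / real m)" D] m by (simp add: field_simps)
  also have "(1 - 1 / real m) ^ D = (1 / real m) ^ D * (real m - 1) ^ D"
    using m by (simp add: field_simps flip: power_mult_distrib)
  finally have "(1 - (1 / real m) ^ D * (real m - 1) ^ D) * ?c \<le> real D / real m * ?c"
    by (intro mult_right_mono op_norm_nonneg finite_configs finite_grid) auto
  then have "U - anderson_bound D d h m
      \<le> real D / real m * ?c - ?l * (1 / (real m - 1) ^ D - 1 / real m ^ D)"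
    by (simp add: U_def anderson_bound_def algebra_simps power_divide)
  \<comment> \<open>As \<open>e\<close> lies between the Anderson bound and \<open>U\<close>, its
    distance from the former is at most their difference.\<close>
  then show ?thesis
    using e_ge e_le by (simp add: e)
qed

end
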